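(* The limit $\displaystyle\lim_{n\to\infty} \frac{E(n,n)}{n^2}$ exists.
   Context: For $m,n\in\mathbb{N}$, $G(m,n)$ is the grid graph on $[m]\times[n]$ with edges between vertices at Euclidean distance 1. In 2-neighbour bootstrap percolation, a vertex becomes infected once at least 2 of its neighbours are infected, infected vertices stay infected; an initial set $A$ percolates if eventually all vertices are infected. A minimal percolating set is a percolating set none of whose proper subsets percolates. $E(m,n)$ is the maximum size of a minimal percolating set of $G(m,n)$. *)

theory Defs
  imports "HOL-Analysis.Analysis"
begin

definition grid :: "nat \<Rightarrow> nat \<Rightarrow> (nat \<times> nat) set" where
  "grid m n = {1..m} \<times> {1..n}"

text \<open>The product metric on \<^typ>\<open>real \<times> real\<close> is the Euclidean one.\<close>

definition grid_adj :: "nat \<times> nat \<Rightarrow> nat \<times> nat \<Rightarrow> bool" where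
  "grid_adj u v \<longleftrightarrow>
     dist (real (fst u), real (snd u)) (real (fst v), real (snd v)) = 1"

definition infect_step :: "nat \<Rightarrow> nat \<Rightarrow> (nat \<times> nat) set \<Rightarrow> (nat \<times> nat) set" where
  "infect_step m n A = A \<union> {v \<in> grid m n. 2 \<le> card {u \<in> A. u \<in> grid m n \<and> grid_adj u v}}"

definition percolates :: "nat \<Rightarrow> nat \<Rightarrow> (nat \<times> nat) set \<Rightarrow> bool" where
  "percolates m n A \<longleftrightarrow>
     A \<subseteq> grid m n \<and> (\<Union>t. (infect_step m n ^^ t) A) = grid m n"

definition minimal_percolating :: "nat \<Rightarrow> nat \<Rightarrow> (nat \<times> nat) set \<Rightarrow> bool" where
  "minimal_percolating m n A \<longleftrightarrow>
     percolates m n A \<and> (\<forall>B. B \<subset> A \<longrightarrow> \<not> percolates m n B)"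

definition E :: "nat \<Rightarrow> nat \<Rightarrow> nat" where
  "E m n = Max {card A |A. minimal_percolating m n A}"

text \<open>The set in the definition of \<^const>\<open>E\<close> is finite and nonempty, so that
  \<^const>\<open>Max\<close> is a true maximum, also for degenerate grids.\<close>

lemma finite_grid: "finite (grid m n)"
  by (simp add: grid_def)

lemma grid_percolates: "percolates m n (grid m n)"
proof -
  have "(infect_step m n ^^ t) (grid m n) = grid m n" for t
    by (induction t) (auto simp: infect_step_def)
  then show ?thesis
    by (simp add: percolates_def)
qed

lemma finite_minimal_percolating_cards: "finite {card A |A. minimal_percolating m n A}"
proof (rule finite_subset)
  show "{card A |A. minimal_percolating m n A} \<subseteq> card ` Pow (grid m n)"
    by (auto simp: minimal_percolating_def percolates_def)
qed (simp add: finite_grid)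

lemma minimal_percolating_exists: "\<exists>A. minimal_percolating m n A"
proof -
  obtain A where A: "percolates m n A"
    and min: "\<And>B. percolates m n B \<Longrightarrow> card A \<le> card B"
    using exists_least_iff[of "\<lambda>k. \<exists>A. percolates m n A \<and> card A = k"] grid_percolates
    by (metis not_le)
  have "finite A"
    using A finite_grid finite_subset unfolding percolates_def by blast
  then have "minimal_percolating m n A"
    unfolding minimal_percolating_def using A min by (meson not_le psubset_card_mono)
  then show ?thesis ..
qed

lemma grid_adj_iff:
  "grid_adj (i, j) (k, l) \<longleftrightarrow>
     (i = k \<and> (j = Suc l \<or> l = Suc j)) \<or> (j = l \<and> (i = Suc k \<or> k = Suc i))"
proof -
  define a b where "a = int i - int k" and "b = int j - int l"
  have "grid_adj (i, j) (k, l) \<longleftrightarrow> (real i - real k)\<^sup>2 + (real j - real l)\<^sup>2 = 1"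
    by (simp add: grid_adj_def dist_Pair_Pair dist_real_def)
  also have "\<dots> \<longleftrightarrow> real_of_int (a\<^sup>2 + b\<^sup>2) = real_of_int 1"
    by (simp add: a_def b_def)
  also have "\<dots> \<longleftrightarrow> a\<^sup>2 + b\<^sup>2 = 1"
    by (simp only: of_int_eq_iff)
  also have "\<dots> \<longleftrightarrow> (a = 0 \<and> \<bar>b\<bar> = 1) \<or> (b = 0 \<and> \<bar>a\<bar> = 1)"
  proof
    assume eq: "a\<^sup>2 + b\<^sup>2 = 1"
    have "a = 0 \<or> b = 0"
    proof (rule ccontr)
      assume "\<not> (a = 0 \<or> b = 0)"
      then have "a\<^sup>2 > 0" "b\<^sup>2 > 0" by simp_all
      with eq show False by linarith
    qed
    with eq show "(a = 0 \<and> \<bar>b\<bar> = 1) \<or> (b = 0 \<and> \<bar>a\<bar> = 1)"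
      by (auto simp: power2_eq_1_iff)
  next
    assume "(a = 0 \<and> \<bar>b\<bar> = 1) \<or> (b = 0 \<and> \<bar>a\<bar> = 1)"
    then show "a\<^sup>2 + b\<^sup>2 = 1"
      by (auto simp: abs_if split: if_splits)
  qed
  also have "\<dots> \<longleftrightarrow>
      (i = k \<and> (j = Suc l \<or> l = Suc j)) \<or> (j = l \<and> (i = Suc k \<or> k = Suc i))"
    unfolding a_def b_def by linarith
  finally show ?thesis .
qed

end

theory Submission
  imports Defs "HOL-Real_Asymp.Real_Asymp"
begin

text \<open>
  A set that is closed under infection, contains \<open>A - {x}\<close> and is not the whole grid certifies
  that \<open>x\<close> is needed, so minimality is proved by exhibiting closed sets.

  Let \<open>A\<close> be minimal in \<open>[a] \<times> [b]\<close>. A new site \<open>(a + 2, 1)\<close> only prolongs a component that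
  already reaches the right side, so it does not help inside \<open>[a] \<times> [b]\<close>; likewise \<open>(1, b + 2)\<close>.
  With both sites added, the corner \<open>(a + 2, b + 2)\<close> is infected only if the right column and
  the top row of \<open>[a] \<times> [b]\<close> are, hence only if no site of \<open>A\<close> is missing. Two such rectangles
  are placed side by side at distance 4, and one more site is put diagonally at the critical
  corner of each. Each rectangle grows by one towards the other only after it has been filled,
  and they merge only after both have grown. This gives
  \<open>E w\<^sub>1 h\<^sub>1 + E w\<^sub>2 h\<^sub>2 \<le> E (w\<^sub>1 + w\<^sub>2 + 7) (h\<^sub>1 + 4)\<close> for \<open>h\<^sub>2 \<le> h\<^sub>1\<close>, and a superadditivity
  argument over square blocks yields the limit: a side \<open>m\<close> is first halved repeatedly (a loss
  absorbed by replacing \<open>m\<close> with \<open>m + 51\<close>) down to a bounded multiple of \<open>k\<close>, and the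
  resulting square is filled with \<open>q \<times> q\<close> squares of side \<open>k\<close>.
\<close>

definition adj :: "int \<times> int \<Rightarrow> int \<times> int \<Rightarrow> bool" where
  "adj u v \<longleftrightarrow> \<bar>fst u - fst v\<bar> + \<bar>snd u - snd v\<bar> = 1"

definition rect :: "int \<Rightarrow> int \<Rightarrow> int \<Rightarrow> int \<Rightarrow> (int \<times> int) set" where
  "rect a b c d = {a..b} \<times> {c..d}"

definition closed_in :: "(int \<times> int) set \<Rightarrow> (int \<times> int) set \<Rightarrow> bool" where
  "closed_in S K \<longleftrightarrow>
     K \<subseteq> S \<and> (\<forall>v\<in>S. \<forall>u\<in>K. \<forall>w\<in>K. u \<noteq> w \<and> adj u v \<and> adj w v \<longrightarrow> v \<in> K)"

definition spans :: "(int \<times> int) set \<Rightarrow> (int \<times> int) set \<Rightarrow> bool" where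
  "spans S A \<longleftrightarrow> A \<subseteq> S \<and> (\<forall>K. closed_in S K \<and> A \<subseteq> K \<longrightarrow> K = S)"

text \<open>For \<open>C = S\<close> this is minimality of \<open>A\<close>; for \<open>C = {c}\<close> it says that the site \<open>c\<close> is not
  infected when any element of \<open>A\<close> is missing.\<close>

definition min_spans :: "(int \<times> int) set \<Rightarrow> (int \<times> int) set \<Rightarrow> (int \<times> int) set \<Rightarrow> bool" where
  "min_spans S A C \<longleftrightarrow>
     spans S A \<and> (\<forall>x\<in>A. \<exists>K. closed_in S K \<and> A - {x} \<subseteq> K \<and> \<not> C \<subseteq> K)"

lemma mem_rect [simp]: "(x, y) \<in> rect a b c d \<longleftrightarrow> a \<le> x \<and> x \<le> b \<and> c \<le> y \<and> y \<le> d"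
  by (auto simp: rect_def)

lemma finite_rect [simp]: "finite (rect a b c d)"
  by (simp add: rect_def)

lemma adj_iff: "adj (x, y) (x', y') \<longleftrightarrow>
    (x' = x \<and> (y' = y + 1 \<or> y' = y - 1)) \<or> (y' = y \<and> (x' = x + 1 \<or> x' = x - 1))"
  unfolding adj_def by auto

lemma closed_inD:
  "closed_in S K \<Longrightarrow> v \<in> S \<Longrightarrow> u \<in> K \<Longrightarrow> w \<in> K \<Longrightarrow> u \<noteq> w \<Longrightarrow> adj u v \<Longrightarrow> adj w v \<Longrightarrow> v \<in> K"
  unfolding closed_in_def by blast

lemma closed_in_subset: "closed_in S K \<Longrightarrow> K \<subseteq> S"
  unfolding closed_in_def by blast

lemma closed_in_Int: "closed_in S K \<Longrightarrow> T \<subseteq> S \<Longrightarrow> closed_in T (K \<inter> T)"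
  unfolding closed_in_def by blast

lemma closed_in_self: "closed_in S S"
  unfolding closed_in_def by blast

lemma closed_in_rect_super:
  assumes L: "closed_in (rect a b c d) L" and S: "rect a b c d \<subseteq> S"
  shows "closed_in S L"
  unfolding closed_in_def
proof (intro conjI ballI impI)
  show "L \<subseteq> S" using closed_in_subset[OF L] S by blast
  fix v u w assume v: "v \<in> S" and u: "u \<in> L" and w: "w \<in> L"
    and *: "u \<noteq> w \<and> adj u v \<and> adj w v"
  have "u \<in> rect a b c d" "w \<in> rect a b c d" using u w closed_in_subset[OF L] by auto
  then have "v \<in> rect a b c d"
    using * by (cases u; cases v; cases w) (auto simp: adj_iff)
  then show "v \<in> L" using closed_inD[OF L] u w * by blast
qed

lemma closed_in_rect: "rect a b c d \<subseteq> S \<Longrightarrow> closed_in S (rect a b c d)"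
  by (rule closed_in_rect_super[OF closed_in_self])

lemma closed_in_singleton: "v \<in> S \<Longrightarrow> closed_in S {v}"
  unfolding closed_in_def by blast

lemma closed_in_Un:
  assumes "closed_in S K" "closed_in S L"
    and "\<And>u w. u \<in> K \<Longrightarrow> w \<in> L \<Longrightarrow> \<bar>fst u - fst w\<bar> + \<bar>snd u - snd w\<bar> > 2"
  shows "closed_in S (K \<union> L)"
proof -
  have far: False if "u \<in> K" "w \<in> L" "adj u v" "adj w v" for u v w
    using assms(3)[OF that(1,2)] that(3,4) unfolding adj_def by linarith
  show ?thesis
    unfolding closed_in_def
  proof (intro conjI ballI impI)
    show "K \<union> L \<subseteq> S" using assms(1,2) closed_in_subset by blast
    fix v u w assume v: "v \<in> S" and "u \<in> K \<union> L" "w \<in> K \<union> L"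
      and *: "u \<noteq> w \<and> adj u v \<and> adj w v"
    then have "(u \<in> K \<and> w \<in> K) \<or> (u \<in> L \<and> w \<in> L)" using far by blast
    then show "v \<in> K \<union> L"
      using closed_inD[OF assms(1) v] closed_inD[OF assms(2) v] * by blast
  qed
qed

lemma closed_in_isometry:
  assumes "bij f" and f: "\<And>u v. adj (f u) (f v) \<longleftrightarrow> adj u v"
  shows "closed_in (f ` S) (f ` K) \<longleftrightarrow> closed_in S K"
  unfolding closed_in_def
  using assms by (simp add: bij_is_inj inj_image_subset_iff inj_image_mem_iff inj_eq)

lemma spans_isometry:
  assumes f: "bij f" "\<And>u v. adj (f u) (f v) \<longleftrightarrow> adj u v" and "spans S A"
  shows "spans (f ` S) (f ` A)"
  unfolding spans_def
proof (intro conjI allI impI)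
  show "f ` A \<subseteq> f ` S" using assms(3) unfolding spans_def by blast
  fix K assume K: "closed_in (f ` S) K \<and> f ` A \<subseteq> K"
  obtain L where L: "K = f ` L" using f(1) by (metis bij_def surj_image_vimage_eq)
  have "closed_in S L" using K closed_in_isometry[OF f] L by blast
  moreover have "A \<subseteq> L" using K L f(1) by (simp add: bij_is_inj inj_image_subset_iff)
  ultimately show "K = f ` S" using assms(3) L unfolding spans_def by blast
qed

lemma min_spans_isometry:
  assumes f: "bij f" "\<And>u v. adj (f u) (f v) \<longleftrightarrow> adj u v" and "min_spans S A C"
  shows "min_spans (f ` S) (f ` A) (f ` C)"
  unfolding min_spans_def
proof (intro conjI ballI)
  show "spans (f ` S) (f ` A)"
    using assms spans_isometry[OF f] unfolding min_spans_def by blast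
  fix x assume "x \<in> f ` A"
  then obtain y where y: "y \<in> A" "x = f y" by blast
  then obtain K where K: "closed_in S K" "A - {y} \<subseteq> K" "\<not> C \<subseteq> K"
    using assms(3) unfolding min_spans_def by blast
  have "closed_in (f ` S) (f ` K)" using closed_in_isometry[OF f] K(1) by blast
  moreover have "f ` A - {x} \<subseteq> f ` K" using K(2) y by blast
  moreover have "\<not> f ` C \<subseteq> f ` K" using K(3) f(1) by (simp add: bij_is_inj inj_image_subset_iff)
  ultimately show "\<exists>K. closed_in (f ` S) K \<and> f ` A - {x} \<subseteq> K \<and> \<not> f ` C \<subseteq> K" by blast
qed

lemma min_spans_subset: "min_spans S A C \<Longrightarrow> A \<subseteq> S"
  unfolding min_spans_def spans_def by blast

lemma bij_swap: "bij (prod.swap :: int \<times> int \<Rightarrow> int \<times> int)"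
  by simp

lemma adj_swap: "adj (prod.swap u) (prod.swap v) \<longleftrightarrow> adj u v"
  by (cases u; cases v) (auto simp: adj_iff)

lemma swap_rect: "prod.swap ` rect a b c d = rect c d a b"
  by (auto simp: rect_def)

definition translate :: "int \<times> int \<Rightarrow> int \<times> int \<Rightarrow> int \<times> int" where
  "translate p u = (fst p + fst u, snd p + snd u)"

definition point_reflect :: "int \<times> int \<Rightarrow> int \<times> int \<Rightarrow> int \<times> int" where
  "point_reflect p u = (fst p - fst u, snd p - snd u)"

lemma bij_translate: "bij (translate p)"
  by (rule bij_betw_byWitness[where f' = "\<lambda>u. (fst u - fst p, snd u - snd p)"])
    (auto simp: translate_def)

lemma bij_point_reflect: "bij (point_reflect p)"
  by (rule bij_betw_byWitness[where f' = "point_reflect p"])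
    (auto simp: point_reflect_def)

lemma adj_translate: "adj (translate p u) (translate p v) \<longleftrightarrow> adj u v"
  by (simp add: adj_def translate_def)

lemma adj_point_reflect: "adj (point_reflect p u) (point_reflect p v) \<longleftrightarrow> adj u v"
  unfolding adj_def point_reflect_def by auto

lemma translate_rect: "translate (p, q) ` rect a b c d = rect (p + a) (p + b) (q + c) (q + d)"
proof (intro equalityI subsetI)
  fix u assume "u \<in> rect (p + a) (p + b) (q + c) (q + d)"
  then have "(fst u - p, snd u - q) \<in> rect a b c d" by (auto simp: rect_def)
  moreover have "u = translate (p, q) (fst u - p, snd u - q)" by (simp add: translate_def)
  ultimately show "u \<in> translate (p, q) ` rect a b c d" by blast
qed (auto simp: rect_def translate_def)

lemma point_reflect_rect:
  "point_reflect (p, q) ` rect a b c d = rect (p - b) (p - a) (q - d) (q - c)"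
proof (intro equalityI subsetI)
  fix u assume "u \<in> rect (p - b) (p - a) (q - d) (q - c)"
  then have "(p - fst u, q - snd u) \<in> rect a b c d" by (auto simp: rect_def)
  moreover have "u = point_reflect (p, q) (p - fst u, q - snd u)" by (simp add: point_reflect_def)
  ultimately show "u \<in> point_reflect (p, q) ` rect a b c d" by blast
qed (auto simp: rect_def point_reflect_def)

lemma column_spread:
  assumes K: "closed_in S K" and S: "\<And>y. c \<le> y \<Longrightarrow> y \<le> d \<Longrightarrow> (x', y) \<in> S"
    and col: "\<And>y. c \<le> y \<Longrightarrow> y \<le> d \<Longrightarrow> (x, y) \<in> K"
    and x': "x' = x + 1 \<or> x' = x - 1"
    and j: "(x', j) \<in> K" "c \<le> j" "j \<le> d" and y: "c \<le> y" "y \<le> d"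
  shows "(x', y) \<in> K"
proof (cases "j \<le> y")
  case True
  then show ?thesis using y(2)
  proof (induction y rule: int_ge_induct)
    case (step i)
    show ?case
    proof (rule closed_inD[OF K])
      show "(x', i) \<in> K" using step by simp
      show "(x, i + 1) \<in> K" "(x', i + 1) \<in> S" using col S step j by simp_all
    qed (use x' in \<open>auto simp: adj_iff\<close>)
  qed (use j in simp)
next
  case False
  then have "y \<le> j" by simp
  then show ?thesis using y(1)
  proof (induction y rule: int_le_induct)
    case (step i)
    show ?case
    proof (rule closed_inD[OF K])
      show "(x', i) \<in> K" using step by simp
      show "(x, i - 1) \<in> K" "(x', i - 1) \<in> S" using col S step j by simp_all
    qed (use x' in \<open>auto simp: adj_iff\<close>)
  qed (use j in simp)
qed

lemma closed_in_swap: "closed_in (prod.swap ` S) (prod.swap ` K) \<longleftrightarrow> closed_in S K"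
  by (rule closed_in_isometry[OF bij_swap adj_swap])

lemma row_spread:
  assumes K: "closed_in S K" and S: "\<And>x. a \<le> x \<Longrightarrow> x \<le> b \<Longrightarrow> (x, y') \<in> S"
    and row: "\<And>x. a \<le> x \<Longrightarrow> x \<le> b \<Longrightarrow> (x, y) \<in> K"
    and y': "y' = y + 1 \<or> y' = y - 1"
    and j: "(j, y') \<in> K" "a \<le> j" "j \<le> b" and x: "a \<le> x" "x \<le> b"
  shows "(x, y') \<in> K"
proof -
  have mem: "(y, x) \<in> prod.swap ` T \<longleftrightarrow> (x, y) \<in> T" for x y :: int and T
    by force
  have "(y', x) \<in> prod.swap ` K"
    by (rule column_spread[where S = "prod.swap ` S" and x = y and j = j and c = a and d = b])
      (use assms closed_in_swap mem in auto)
  then show ?thesis using mem by blast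
qed

lemma closed_in_corner_full:
  assumes L: "closed_in (rect 1 a 1 b) L"
    and col: "\<And>y. 1 \<le> y \<Longrightarrow> y \<le> b \<Longrightarrow> (a, y) \<in> L"
    and row: "\<And>x. 1 \<le> x \<Longrightarrow> x \<le> a \<Longrightarrow> (x, b) \<in> L" and b: "1 \<le> b"
  shows "L = rect 1 a 1 b"
proof -
  have "(x, y) \<in> L" if "x \<le> a" "1 \<le> x" "1 \<le> y" "y \<le> b" for x y
    using that
  proof (induction x arbitrary: y rule: int_le_induct)
    case (step i)
    show ?case
      by (rule column_spread[OF L, where x = i and j = b and c = 1 and d = b])
        (use step row b in auto)
  qed (use col in simp)
  then show ?thesis using closed_in_subset[OF L] by auto
qed

subsection \<open>Making a corner critical\<close>

text \<open>A closed set containing \<open>L\<close> and the new site: only the component meeting the right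
  side at height 1 is prolonged, as prolonging every one would infect the corner too early.\<close>

definition pad :: "int \<Rightarrow> int \<Rightarrow> (int \<times> int) set \<Rightarrow> (int \<times> int) set" where
  "pad a b L = L \<union> {(a + 2, 1)} \<union>
     {(x, y). (x = a + 1 \<or> x = a + 2) \<and> 1 \<le> y \<and> y \<le> b \<and> (\<forall>i\<in>{1..y}. (a, i) \<in> L)}"

lemma closed_in_pad:
  assumes L: "closed_in (rect 1 a 1 b) L" and ab: "1 \<le> a" "1 \<le> b"
  shows "closed_in (rect 1 (a + 2) 1 b) (pad a b L)"
  unfolding closed_in_def
proof (intro conjI ballI impI)
  define R where "R y \<longleftrightarrow> (\<forall>i\<in>{1..y}. (a, i) \<in> L)" for y
  have R_le: "R y" if "R (y + 1)" for y
    using that unfolding R_def by simp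
  have R_L: "(a, y) \<in> L" if "R y" "1 \<le> y" for y
    using that unfolding R_def by simp
  have R_Suc: "R y" if "R (y - 1)" "(a, y) \<in> L" for y
    unfolding R_def
  proof
    fix i assume "i \<in> {1..y}"
    then show "(a, i) \<in> L" using that unfolding R_def by (cases "i = y") auto
  qed
  have R1: "R 1" if "(a, 1) \<in> L"
    using R_Suc[of 1] that by (simp add: R_def)
  have sub: "L \<subseteq> rect 1 a 1 b" by (rule closed_in_subset[OF L])
  have L_bd: "x \<le> a" "1 \<le> x" "1 \<le> y" "y \<le> b" if "(x, y) \<in> L" for x y
    using that sub by auto
  have mem: "(x, y) \<in> pad a b L \<longleftrightarrow> (x, y) \<in> L \<or> (x = a + 2 \<and> y = 1) \<or>
      ((x = a + 1 \<or> x = a + 2) \<and> 1 \<le> y \<and> y \<le> b \<and> R y)" for x y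
    unfolding pad_def R_def by auto
  show "pad a b L \<subseteq> rect 1 (a + 2) 1 b"
    using ab L_bd by (force simp: mem)
  fix v u w assume v: "v \<in> rect 1 (a + 2) 1 b" and u: "u \<in> pad a b L" and w: "w \<in> pad a b L"
    and *: "u \<noteq> w \<and> adj u v \<and> adj w v"
  obtain x y where xy: "v = (x, y)" by (cases v)
  obtain u1 u2 where uu: "u = (u1, u2)" by (cases u)
  obtain w1 w2 where ww: "w = (w1, w2)" by (cases w)
  show "v \<in> pad a b L"
  proof (rule ccontr)
    assume nv: "v \<notin> pad a b L"
    consider "x \<le> a" | "x = a + 1" | "x = a + 2" using v xy by force
    then show False
    proof cases
      case 1
      have in_L: "(p, q) \<in> L" if "(p, q) \<in> pad a b L" "adj (p, q) v" for p q
        using that nv 1 xy R_L L_bd by (auto simp: mem adj_iff)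
      have "v \<in> L"
        by (rule closed_inD[OF L, of v u w]) (use v xy 1 uu ww u w * in_L in auto)
      then show False using nv xy mem by blast
    next
      case 2
      have nR: "\<not> R y" "1 \<le> y" "y \<le> b" using nv 2 v xy by (auto simp: mem)
      have nb: "((p, q) = (a, y) \<and> (a, y) \<in> L) \<or> ((p, q) = (a + 2, y) \<and> y = 1) \<or>
          ((p, q) = (a + 1, y - 1) \<and> R (y - 1) \<and> 2 \<le> y)"
        if "(p, q) \<in> pad a b L" "adj (p, q) v" for p q
        using that(1) that(2)[unfolded xy 2 adj_iff] nR R_le[of y] L_bd[of p q]
        unfolding mem by smt
      show False
        using nb[of u1 u2] nb[of w1 w2] u w uu ww * nR R_Suc[of y] R1 by auto
    next
      case 3
      have nR: "\<not> R y" "1 \<le> y" "y \<le> b" using nv 3 v xy by (auto simp: mem)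
      have nb: "(p, q) = (a + 2, y - 1)"
        if "(p, q) \<in> pad a b L" "adj (p, q) v" for p q
        using that nR 3 xy R_le[of y] L_bd[of p q] by (auto simp: mem adj_iff)
      show False
        using nb[of u1 u2] nb[of w1 w2] u w uu ww * by auto
    qed
  qed
qed


lemma spans_pad:
  assumes A: "spans (rect 1 a 1 b) A" and ab: "1 \<le> a" "1 \<le> b"
  shows "spans (rect 1 (a + 2) 1 b) (insert (a + 2, 1) A)"
  unfolding spans_def
proof (intro conjI allI impI)
  let ?S = "rect 1 (a + 2) 1 b"
  have sub: "rect 1 a 1 b \<subseteq> ?S" by (auto simp: rect_def)
  show "insert (a + 2, 1) A \<subseteq> ?S" using A ab sub unfolding spans_def by auto
  fix K assume K: "closed_in ?S K \<and> insert (a + 2, 1) A \<subseteq> K"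
  then have cK: "closed_in ?S K" by blast
  have "A \<subseteq> K \<inter> rect 1 a 1 b" using K A unfolding spans_def by blast
  then have "K \<inter> rect 1 a 1 b = rect 1 a 1 b"
    using A closed_in_Int[OF cK sub] unfolding spans_def by blast
  then have V: "(x, y) \<in> K" if "1 \<le> x" "x \<le> a" "1 \<le> y" "y \<le> b" for x y
    using that by force
  have "(a + 1, 1) \<in> K"
    by (rule closed_inD[OF cK, where u = "(a, 1)" and w = "(a + 2, 1)"])
      (use K V ab in \<open>auto simp: adj_iff\<close>)
  then have c1: "(a + 1, y) \<in> K" if "1 \<le> y" "y \<le> b" for y
    using column_spread[OF cK, where x = a and x' = "a + 1" and j = 1 and c = 1 and d = b] V ab that
    by auto
  have c2: "(a + 2, y) \<in> K" if "1 \<le> y" "y \<le> b" for y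
    using column_spread[OF cK, where x = "a + 1" and x' = "a + 2" and j = 1 and c = 1 and d = b]
      c1 K ab that
    by auto
  have "(x, y) \<in> K" if xy: "(x, y) \<in> ?S" for x y
  proof -
    have "x \<le> a \<or> x = a + 1 \<or> x = a + 2" using xy by auto
    then show ?thesis using V c1 c2 xy by auto
  qed
  then show "K = ?S" using closed_in_subset[OF cK] by auto
qed

definition pad_up :: "int \<Rightarrow> int \<Rightarrow> (int \<times> int) set \<Rightarrow> (int \<times> int) set" where
  "pad_up a b L = prod.swap ` pad b a (prod.swap ` L)"

lemma mem_swap_image: "(y, x) \<in> prod.swap ` T \<longleftrightarrow> (x, y) \<in> T"
  by force

lemma closed_in_pad_up:
  assumes L: "closed_in (rect 1 a 1 b) L" and ab: "1 \<le> a" "1 \<le> b"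
  shows "closed_in (rect 1 a 1 (b + 2)) (pad_up a b L)"
proof -
  have "closed_in (rect 1 b 1 a) (prod.swap ` L)"
    using L closed_in_swap[of "rect 1 a 1 b" L] by (simp add: swap_rect)
  then have "closed_in (rect 1 (b + 2) 1 a) (pad b a (prod.swap ` L))"
    by (rule closed_in_pad[OF _ ab(2,1)])
  then show ?thesis
    using closed_in_swap[of "rect 1 (b + 2) 1 a" "pad b a (prod.swap ` L)"]
    by (simp add: swap_rect pad_up_def)
qed

lemma mem_pad_up:
  "(x, y) \<in> pad_up a b L \<longleftrightarrow> (x, y) \<in> L \<or> (x = 1 \<and> y = b + 2) \<or>
     ((y = b + 1 \<or> y = b + 2) \<and> 1 \<le> x \<and> x \<le> a \<and> (\<forall>i\<in>{1..x}. (i, b) \<in> L))"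
  unfolding pad_up_def mem_swap_image by (auto simp: pad_def mem_swap_image)

lemma spans_pad_up:
  assumes A: "spans (rect 1 a 1 b) A" and ab: "1 \<le> a" "1 \<le> b"
  shows "spans (rect 1 a 1 (b + 2)) (insert (1, b + 2) A)"
proof -
  have "spans (rect 1 b 1 a) (prod.swap ` A)"
    using spans_isometry[OF bij_swap adj_swap A] by (simp add: swap_rect)
  from spans_isometry[OF bij_swap adj_swap spans_pad[OF this ab(2,1)]] show ?thesis
    by (simp add: swap_rect image_image)
qed

lemma min_spans_corner:
  assumes A: "min_spans (rect 1 a 1 b) A (rect 1 a 1 b)" and ab: "1 \<le> a" "1 \<le> b"
  shows "min_spans (rect 1 (a + 2) 1 (b + 2)) (insert (1, b + 2) (insert (a + 2, 1) A))
    {(a + 2, b + 2)}"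
  unfolding min_spans_def
proof (intro conjI ballI)
  let ?V = "rect 1 a 1 b" and ?S = "rect 1 (a + 2) 1 (b + 2)"
  let ?s = "(a + 2, 1)" and ?t = "(1, b + 2)" and ?c = "(a + 2, b + 2)"
  have spA: "spans ?V A" using A unfolding min_spans_def by blast
  have sub: "A \<subseteq> ?V" using spA unfolding spans_def by blast
  show "spans ?S (insert ?t (insert ?s A))"
    using spans_pad_up[OF spans_pad[OF spA ab]] ab by simp
  fix x assume "x \<in> insert ?t (insert ?s A)"
  then consider "x = ?t" | "x = ?s" | "x \<in> A" by blast
  then show "\<exists>K. closed_in ?S K \<and> insert ?t (insert ?s A) - {x} \<subseteq> K \<and> \<not> {?c} \<subseteq> K"
  proof cases
    case 1
    have "closed_in ?S (rect 1 (a + 2) 1 b)" by (rule closed_in_rect) (auto simp: rect_def)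
    moreover have "insert ?t (insert ?s A) - {x} \<subseteq> rect 1 (a + 2) 1 b"
      using sub ab 1 by (force simp: rect_def)
    moreover have "?c \<notin> rect 1 (a + 2) 1 b" by simp
    ultimately show ?thesis by blast
  next
    case 2
    have "closed_in (rect 1 (a + 2) 1 b) ?V" by (rule closed_in_rect) (auto simp: rect_def)
    then have "closed_in ?S (pad_up (a + 2) b ?V)" using closed_in_pad_up ab by simp
    moreover have "insert ?t (insert ?s A) - {x} \<subseteq> pad_up (a + 2) b ?V"
      using sub 2 by (force simp: mem_pad_up)
    moreover have "?c \<notin> pad_up (a + 2) b ?V"
      using ab by (auto simp: mem_pad_up intro!: bexI[of _ "a + 2"])
    ultimately show ?thesis by blast
  next
    case 3
    then obtain L where L: "closed_in ?V L" "A - {x} \<subseteq> L" "\<not> ?V \<subseteq> L"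
      using A unfolding min_spans_def by blast
    have LV: "L \<subseteq> ?V" by (rule closed_in_subset[OF L(1)])
    let ?M = "pad a b L"
    have "closed_in ?S (pad_up (a + 2) b ?M)"
      using closed_in_pad_up[OF closed_in_pad[OF L(1) ab]] ab by simp
    moreover have "insert ?t (insert ?s A) - {x} \<subseteq> pad_up (a + 2) b ?M"
      using L(2) by (force simp: mem_pad_up pad_def)
    moreover have "?c \<notin> pad_up (a + 2) b ?M"
    proof
      assume "?c \<in> pad_up (a + 2) b ?M"
      then have row: "(i, b) \<in> ?M" if "1 \<le> i" "i \<le> a + 2" for i
        using that ab LV by (auto simp: mem_pad_up pad_def)
      have row': "(i, b) \<in> L" if "1 \<le> i" "i \<le> a" for i
        using row[of i] that by (auto simp: pad_def)
      have col: "(a, i) \<in> L" if "1 \<le> i" "i \<le> b" for i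
        using row[of "a + 1"] that ab LV by (auto simp: pad_def)
      show False using closed_in_corner_full[OF L(1) col row' ab(2)] L(3) by blast
    qed
    ultimately show ?thesis by blast
  qed
qed

subsection \<open>Joining two rectangles\<close>

lemma spans_subrect:
  assumes "closed_in S K" "spans R A" "R \<subseteq> S" "A \<subseteq> K"
  shows "R \<subseteq> K"
proof -
  have "A \<subseteq> K \<inter> R" using assms unfolding spans_def by blast
  then show ?thesis using assms closed_in_Int[OF assms(1,3)] unfolding spans_def by blast
qed

lemma corner_extend:
  assumes K: "closed_in S K" and S: "rect 1 (a + 1) 1 (b + 1) \<subseteq> S" and ab: "1 \<le> a" "1 \<le> b"
    and R: "rect 1 a 1 b \<subseteq> K" and g: "(a + 1, b + 1) \<in> K"
  shows "rect 1 (a + 1) 1 (b + 1) \<subseteq> K"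
proof -
  have V: "(x, y) \<in> K" if "1 \<le> x" "x \<le> a" "1 \<le> y" "y \<le> b" for x y
    using that R by auto
  have SS: "(x, y) \<in> S" if "1 \<le> x" "x \<le> a + 1" "1 \<le> y" "y \<le> b + 1" for x y
    using that S by auto
  have "(a + 1, b) \<in> K"
    by (rule closed_inD[OF K, where u = "(a, b)" and w = "(a + 1, b + 1)"])
      (use V SS ab g in \<open>auto simp: adj_iff\<close>)
  then have c1: "(a + 1, y) \<in> K" if "1 \<le> y" "y \<le> b" for y
    using column_spread[OF K, where x = a and x' = "a + 1" and j = b and c = 1 and d = b] V SS ab that
    by auto
  have c2: "(x, b) \<in> K" if "1 \<le> x" "x \<le> a + 1" for x
    using c1[of b] V[of x b] that ab by (cases "x = a + 1") auto
  have r: "(x, b + 1) \<in> K" if "1 \<le> x" "x \<le> a + 1" for x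
    using row_spread[OF K, where y = b and y' = "b + 1" and j = "a + 1" and a = 1 and b = "a + 1"]
      c2 SS g ab that
    by auto
  show ?thesis
  proof
    fix v assume "v \<in> rect 1 (a + 1) 1 (b + 1)"
    then obtain x y where v: "v = (x, y)" "1 \<le> x" "x \<le> a + 1" "1 \<le> y" "y \<le> b + 1"
      by (cases v) auto
    consider "y = b + 1" | "x = a + 1" "y \<le> b" | "x \<le> a" "y \<le> b" using v by linarith
    then show "v \<in> K" using v r c1 V by cases auto
  qed
qed

lemma corner_extend_down:
  assumes K: "closed_in S K" and S: "rect (a - 1) b (c - 1) d \<subseteq> S" and ab: "a \<le> b" "c \<le> d"
    and R: "rect a b c d \<subseteq> K" and g: "(a - 1, c - 1) \<in> K"
  shows "rect (a - 1) b (c - 1) d \<subseteq> K"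
proof -
  let ?f = "point_reflect (b + 1, d + 1)"
  have inv: "?f ` ?f ` T = T" for T
    by (force simp: point_reflect_def image_image)
  have "rect 1 (b - a + 1 + 1) 1 (d - c + 1 + 1) \<subseteq> ?f ` K"
  proof (rule corner_extend)
    show "closed_in (?f ` S) (?f ` K)"
      using K closed_in_isometry[OF bij_point_reflect adj_point_reflect] by blast
    show "rect 1 (b - a + 1 + 1) 1 (d - c + 1 + 1) \<subseteq> ?f ` S"
      using image_mono[OF S, of ?f] by (simp add: point_reflect_rect algebra_simps)
    show "rect 1 (b - a + 1) 1 (d - c + 1) \<subseteq> ?f ` K"
      using image_mono[OF R, of ?f] by (simp add: point_reflect_rect algebra_simps)
    have "?f (a - 1, c - 1) \<in> ?f ` K" using g by blast
    then show "(b - a + 1 + 1, d - c + 1 + 1) \<in> ?f ` K"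
      by (simp add: point_reflect_def algebra_simps)
  qed (use ab in simp_all)
  then have "?f ` rect 1 (b - a + 1 + 1) 1 (d - c + 1 + 1) \<subseteq> ?f ` ?f ` K" by blast
  then show ?thesis unfolding inv by (simp add: point_reflect_rect algebra_simps)
qed

lemma min_spans_join:
  assumes A: "min_spans (rect 1 a 1 b) A {(a, b)}"
    and B: "min_spans (rect (a + 4) w 1 d) B {(a + 4, 1)}"
    and bds: "1 \<le> a" "1 \<le> d" "d \<le> b" "a + 4 \<le> w"
  shows "min_spans (rect 1 w 0 (b + 1)) (insert (a + 1, b + 1) (insert (a + 3, 0) (A \<union> B)))
    (rect 1 w 0 (b + 1))"
  unfolding min_spans_def
proof (intro conjI ballI)
  let ?R = "rect 1 a 1 b" and ?Q = "rect (a + 4) w 1 d" and ?S = "rect 1 w 0 (b + 1)"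
  let ?R' = "rect 1 (a + 1) 1 (b + 1)" and ?Q' = "rect (a + 3) w 0 d"
  let ?g = "(a + 1, b + 1)" and ?h = "(a + 3, 0 :: int)"
  let ?A = "insert ?g (insert ?h (A \<union> B))"
  have spA: "spans ?R A" and spB: "spans ?Q B" using A B unfolding min_spans_def by auto
  have subs: "?R \<subseteq> ?R'" "?R' \<subseteq> ?S" "?Q \<subseteq> ?Q'" "?Q' \<subseteq> ?S" "?R \<subseteq> ?S" "?Q \<subseteq> ?S"
    and gh: "?g \<in> ?S" "?h \<in> ?S" "?g \<in> ?R'" "?h \<in> ?Q'"
    using bds by (auto simp: rect_def)
  have AR: "A \<subseteq> ?R" and BQ: "B \<subseteq> ?Q" using spA spB unfolding spans_def by auto
  have dist_le: "\<bar>fst u - fst w\<bar> + \<bar>snd u - snd w\<bar> > 2" if "fst u \<le> fst w - 3" for u w :: "int \<times> int"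
    using that by linarith
  show "spans ?S ?A"
    unfolding spans_def
  proof (intro conjI allI impI)
    show "?A \<subseteq> ?S" using AR BQ subs gh by blast
    fix K assume "closed_in ?S K \<and> ?A \<subseteq> K"
    then have K: "closed_in ?S K" and AK: "?A \<subseteq> K" by auto
    have "?R \<subseteq> K" by (rule spans_subrect[OF K spA]) (use subs AK in auto)
    then have R': "?R' \<subseteq> K"
      by (intro corner_extend[OF K]) (use subs bds AK in auto)
    have "?Q \<subseteq> K" by (rule spans_subrect[OF K spB]) (use subs AK in auto)
    then have "rect (a + 4 - 1) w (1 - 1) d \<subseteq> K"
      by (intro corner_extend_down[OF K]) (use subs bds AK in \<open>auto simp: add.commute\<close>)
    then have Q': "?Q' \<subseteq> K" by (simp add: add.commute)
    have "(a + 2, 1) \<in> K"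
      by (rule closed_inD[OF K, where u = "(a + 1, 1)" and w = "(a + 3, 1)"])
        (use R' Q' bds in \<open>auto simp: adj_iff\<close>)
    then have one: "(x, 1) \<in> K" if "1 \<le> x" "x \<le> w" for x
    proof -
      consider "x \<le> a + 1" | "x = a + 2" | "a + 3 \<le> x" by linarith
      then show ?thesis using that R' Q' \<open>(a + 2, 1) \<in> K\<close> bds by cases auto
    qed
    have up: "(x, y) \<in> K" if "a + 1 \<le> x" "x \<le> w" "1 \<le> y" "y \<le> b + 1" for x y
      using that
    proof (induction x arbitrary: y rule: int_ge_induct)
      case base
      then show ?case using R' bds by auto
    next
      case (step i)
      show ?case
        by (rule column_spread[OF K, where x = i and j = 1 and c = 1 and d = "b + 1"])
          (use step one bds in auto)
    qed
    have zero: "(x, 0) \<in> K" if "1 \<le> x" "x \<le> w" for x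
      by (rule row_spread[OF K, where y = 1 and j = "a + 3" and a = 1 and b = w])
        (use one that AK bds in auto)
    have "(x, y) \<in> K" if xy: "(x, y) \<in> ?S" for x y
    proof -
      consider "y = 0" | "1 \<le> y" "a + 1 \<le> x" | "1 \<le> y" "x \<le> a" using xy by force
      then show ?thesis using xy zero up R' by cases auto
    qed
    then show "K = ?S" using closed_in_subset[OF K] by auto
  qed
  have left: "closed_in ?S (L \<union> {?g} \<union> ?Q')" if L: "closed_in ?R L" "(a, b) \<notin> L" for L
  proof (intro closed_in_Un)
    show "closed_in ?S L" using closed_in_rect_super[OF L(1)] subs by blast
    show "closed_in ?S {?g}" using gh by (intro closed_in_singleton)
    show "closed_in ?S ?Q'" using subs by (intro closed_in_rect)
    fix u v assume uv: "u \<in> L" "v \<in> {?g}"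
    obtain x y where u: "u = (x, y)" by (cases u)
    have "x \<le> a" "y \<le> b" "x \<noteq> a \<or> y \<noteq> b"
      using uv L closed_in_subset[OF L(1)] u by auto
    then show "\<bar>fst u - fst v\<bar> + \<bar>snd u - snd v\<bar> > 2" using u uv by auto
  next
    fix u v assume uv: "u \<in> L \<union> {?g}" "v \<in> ?Q'"
    obtain x y where v: "v = (x, y)" by (cases v)
    show "\<bar>fst u - fst v\<bar> + \<bar>snd u - snd v\<bar> > 2"
    proof (cases "u = ?g")
      case True
      then show ?thesis using uv v bds by auto
    next
      case False
      then have "u \<in> ?R" using uv closed_in_subset[OF L(1)] by auto
      then have "fst u \<le> a" by (auto simp: rect_def)
      then show ?thesis using uv v by (intro dist_le) auto
    qed
  qed
  have right: "closed_in ?S (L \<union> {?h} \<union> ?R')" if L: "closed_in ?Q L" "(a + 4, 1) \<notin> L" for L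
  proof (intro closed_in_Un)
    show "closed_in ?S L" using closed_in_rect_super[OF L(1)] subs by blast
    show "closed_in ?S {?h}" using gh by (intro closed_in_singleton)
    show "closed_in ?S ?R'" using subs by (intro closed_in_rect)
    fix u v assume uv: "u \<in> L" "v \<in> {?h}"
    obtain x y where u: "u = (x, y)" by (cases u)
    have "a + 4 \<le> x" "1 \<le> y" "x \<noteq> a + 4 \<or> y \<noteq> 1"
      using uv L closed_in_subset[OF L(1)] u by auto
    then show "\<bar>fst u - fst v\<bar> + \<bar>snd u - snd v\<bar> > 2" using u uv by auto
  next
    fix u v assume uv: "u \<in> L \<union> {?h}" "v \<in> ?R'"
    obtain x y where v: "v = (x, y)" by (cases v)
    obtain x' y' where u: "u = (x', y')" by (cases u)
    show "\<bar>fst u - fst v\<bar> + \<bar>snd u - snd v\<bar> > 2"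
    proof (cases "u = ?h")
      case True
      then show ?thesis using uv v bds by auto
    next
      case False
      then have "u \<in> ?Q" using uv closed_in_subset[OF L(1)] by auto
      then show ?thesis using uv v u by auto
    qed
  qed
  fix x assume "x \<in> ?A"
  then consider "x = ?g" | "x = ?h" | "x \<in> A" | "x \<in> B" by blast
  then show "\<exists>K. closed_in ?S K \<and> ?A - {x} \<subseteq> K \<and> \<not> ?S \<subseteq> K"
  proof cases
    case 1
    have "closed_in ?S (?R \<union> ?Q')"
    proof (intro closed_in_Un closed_in_rect subs)
      fix u v assume "u \<in> ?R" "v \<in> ?Q'"
      then show "\<bar>fst u - fst v\<bar> + \<bar>snd u - snd v\<bar> > 2" by (intro dist_le) (auto simp: rect_def)
    qed
    moreover have "?A - {x} \<subseteq> ?R \<union> ?Q'" using 1 AR BQ subs gh by blast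
    moreover have "?g \<notin> ?R \<union> ?Q'" by simp
    ultimately show ?thesis using gh by blast
  next
    case 2
    have "closed_in ?S (?R' \<union> ?Q)"
    proof (intro closed_in_Un closed_in_rect subs)
      fix u v assume "u \<in> ?R'" "v \<in> ?Q"
      then show "\<bar>fst u - fst v\<bar> + \<bar>snd u - snd v\<bar> > 2" by (intro dist_le) (auto simp: rect_def)
    qed
    moreover have "?A - {x} \<subseteq> ?R' \<union> ?Q" using 2 AR BQ subs gh by blast
    moreover have "?h \<notin> ?R' \<union> ?Q" by simp
    ultimately show ?thesis using gh by blast
  next
    case 3
    then obtain L where L: "closed_in ?R L" "A - {x} \<subseteq> L" "(a, b) \<notin> L"
      using A unfolding min_spans_def by blast
    have "(a, b) \<notin> L \<union> {?g} \<union> ?Q'" "(a, b) \<in> ?S" using L bds by auto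
    moreover have "?A - {x} \<subseteq> L \<union> {?g} \<union> ?Q'" using L BQ subs gh by blast
    ultimately show ?thesis using left[OF L(1,3)] by blast
  next
    case 4
    then obtain L where L: "closed_in ?Q L" "B - {x} \<subseteq> L" "(a + 4, 1) \<notin> L"
      using B unfolding min_spans_def by blast
    have "(a + 4, 1) \<notin> L \<union> {?h} \<union> ?R'" "(a + 4, 1) \<in> ?S" using L bds by auto
    moreover have "?A - {x} \<subseteq> L \<union> {?h} \<union> ?R'" using L AR subs gh by blast
    ultimately show ?thesis using right[OF L(1,3)] by blast
  qed
qed

subsection \<open>Transfer to the extremal function\<close>

definition int_point :: "nat \<times> nat \<Rightarrow> int \<times> int" where
  "int_point u = (int (fst u), int (snd u))"

lemma inj_int_point: "inj int_point"
  by (rule injI) (auto simp: int_point_def prod_eq_iff)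

lemma int_point_grid: "int_point ` grid m n = rect 1 (int m) 1 (int n)"
proof (intro equalityI subsetI)
  fix u assume "u \<in> rect 1 (int m) 1 (int n)"
  then have "(nat (fst u), nat (snd u)) \<in> grid m n" "u = int_point (nat (fst u), nat (snd u))"
    by (auto simp: rect_def grid_def int_point_def)
  then show "u \<in> int_point ` grid m n" by blast
qed (auto simp: grid_def int_point_def)

lemma adj_int_point: "adj (int_point u) (int_point v) \<longleftrightarrow> grid_adj u v"
  by (cases u; cases v) (auto simp: int_point_def adj_iff grid_adj_iff)

lemma infect_step_mono_iterates:
  "s \<le> t \<Longrightarrow> (infect_step m n ^^ s) A \<subseteq> (infect_step m n ^^ t) A"
  by (rule lift_Suc_mono_le) (auto simp: infect_step_def)

lemma spans_iff_percolates:
  "spans (rect 1 (int m) 1 (int n)) (int_point ` A) \<longleftrightarrow> percolates m n A"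
proof
  let ?S = "rect 1 (int m) 1 (int n)"
  let ?I = "\<lambda>t. (infect_step m n ^^ t) A"
  assume sp: "spans ?S (int_point ` A)"
  have AG: "A \<subseteq> grid m n"
    using sp inj_image_subset_iff[OF inj_int_point] unfolding spans_def int_point_grid[symmetric]
    by blast
  define U where "U = (\<Union>t. ?I t)"
  have It: "?I t \<subseteq> grid m n" for t
    by (induction t) (use AG in \<open>auto simp: infect_step_def\<close>)
  have UG: "U \<subseteq> grid m n" using It unfolding U_def by blast
  have "closed_in ?S (int_point ` U)"
    unfolding closed_in_def
  proof (intro conjI ballI impI)
    show "int_point ` U \<subseteq> ?S" using UG unfolding int_point_grid[symmetric] by blast
    fix v u w assume "v \<in> ?S" "u \<in> int_point ` U" "w \<in> int_point ` U"
      and *: "u \<noteq> w \<and> adj u v \<and> adj w v"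
    then have "v \<in> int_point ` grid m n" "u \<in> int_point ` U" "w \<in> int_point ` U"
      unfolding int_point_grid by auto
    then obtain v' u' w' where v: "v = int_point v'" "v' \<in> grid m n"
      and u: "u = int_point u'" "u' \<in> U" and w: "w = int_point w'" "w' \<in> U"
      by (elim imageE)
    obtain s t where "u' \<in> ?I s" "w' \<in> ?I t" using u w unfolding U_def by blast
    then have uw: "u' \<in> ?I (max s t)" "w' \<in> ?I (max s t)"
      using infect_step_mono_iterates[of s "max s t" m n A]
        infect_step_mono_iterates[of t "max s t" m n A] by auto
    let ?N = "{z \<in> ?I (max s t). z \<in> grid m n \<and> grid_adj z v'}"
    have "{u', w'} \<subseteq> ?N" using uw u w UG * v by (auto simp: adj_int_point)
    moreover have "finite ?N" by (rule finite_subset[OF _ finite_grid[of m n]]) blast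
    ultimately have "card {u', w'} \<le> card ?N" by (intro card_mono)
    moreover have "u' \<noteq> w'" using * u w by blast
    ultimately have "2 \<le> card ?N" by simp
    then have "v' \<in> ?I (Suc (max s t))" using v(2) by (simp add: infect_step_def)
    then have "v' \<in> U" unfolding U_def by blast
    then show "v \<in> int_point ` U" using v by blast
  qed
  moreover have "A \<subseteq> U" unfolding U_def using UN_upper[of 0 UNIV ?I] by simp
  ultimately have "int_point ` U = int_point ` grid m n"
    using sp unfolding spans_def int_point_grid by blast
  then have "U = grid m n" by (simp add: inj_image_eq_iff[OF inj_int_point])
  then show "percolates m n A" using AG unfolding percolates_def U_def by blast
next
  let ?S = "rect 1 (int m) 1 (int n)"
  let ?I = "\<lambda>t. (infect_step m n ^^ t) A"
  assume p: "percolates m n A"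
  then have AG: "A \<subseteq> grid m n" and U: "(\<Union>t. ?I t) = grid m n" unfolding percolates_def by auto
  show "spans ?S (int_point ` A)"
    unfolding spans_def
  proof (intro conjI allI impI)
    show "int_point ` A \<subseteq> ?S" using AG unfolding int_point_grid[symmetric] by blast
    fix K assume K: "closed_in ?S K \<and> int_point ` A \<subseteq> K"
    have "int_point ` ?I t \<subseteq> K" for t
    proof (induction t)
      case (Suc t)
      show ?case
      proof
        fix z assume "z \<in> int_point ` ?I (Suc t)"
        then obtain v where v: "z = int_point v" "v \<in> infect_step m n (?I t)" by auto
        show "z \<in> K"
        proof (cases "v \<in> ?I t")
          case False
          let ?N = "{u \<in> ?I t. u \<in> grid m n \<and> grid_adj u v}"
          have vG: "v \<in> grid m n" and N: "2 \<le> card ?N" using v False by (auto simp: infect_step_def)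
          obtain T where "T \<subseteq> ?N" "card T = 2" using N by (rule obtain_subset_with_card_n)
          then obtain u w where uw: "u \<noteq> w" "u \<in> ?N" "w \<in> ?N"
            unfolding card_2_iff by blast
          have "int_point v \<in> K"
          proof (rule closed_inD[of ?S K _ "int_point u" "int_point w"])
            show "int_point v \<in> ?S" using vG unfolding int_point_grid[symmetric] by (rule imageI)
            show "int_point u \<noteq> int_point w" using uw(1) injD[OF inj_int_point] by blast
          qed (use K Suc uw in \<open>auto simp: adj_int_point\<close>)
          then show ?thesis using v by simp
        qed (use Suc v in auto)
      qed
    qed (use K in simp)
    then have "int_point ` grid m n \<subseteq> K" unfolding U[symmetric] by blast
    then show "K = ?S" using K closed_in_subset unfolding int_point_grid by blast
  qed
qed

lemma min_spans_iff_minimal_percolating: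
  "min_spans (rect 1 (int m) 1 (int n)) (int_point ` A) (rect 1 (int m) 1 (int n)) \<longleftrightarrow>
     minimal_percolating m n A"
proof
  let ?S = "rect 1 (int m) 1 (int n)"
  assume A: "min_spans ?S (int_point ` A) ?S"
  show "minimal_percolating m n A"
    unfolding minimal_percolating_def
  proof (intro conjI allI impI notI)
    show "percolates m n A" using A spans_iff_percolates unfolding min_spans_def by blast
    fix B assume B: "B \<subset> A" "percolates m n B"
    then obtain a where a: "a \<in> A" "a \<notin> B" by blast
    then obtain K where K: "closed_in ?S K" "int_point ` A - {int_point a} \<subseteq> K" "\<not> ?S \<subseteq> K"
      using A unfolding min_spans_def by blast
    have "int_point a \<notin> int_point ` B"
      using a inj_image_mem_iff[OF inj_int_point, of a B] by simp
    moreover have "int_point ` B \<subseteq> int_point ` A" using B(1) by (intro image_mono) simp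
    ultimately have "int_point ` B \<subseteq> int_point ` A - {int_point a}"
      by (simp only: subset_Diff_insert Diff_empty simp_thms)
    then have "int_point ` B \<subseteq> K" using K(2) by (rule order_trans)
    then have "K = ?S" using K(1) B(2) spans_iff_percolates unfolding spans_def by blast
    then show False using K(3) by blast
  qed
next
  let ?S = "rect 1 (int m) 1 (int n)"
  assume A: "minimal_percolating m n A"
  show "min_spans ?S (int_point ` A) ?S"
    unfolding min_spans_def
  proof (intro conjI ballI)
    show sp: "spans ?S (int_point ` A)"
      using A spans_iff_percolates unfolding minimal_percolating_def by blast
    fix x assume "x \<in> int_point ` A"
    then obtain a where a: "a \<in> A" "x = int_point a" by (elim imageE)
    then have "A - {a} \<subset> A" by blast
    then have "\<not> percolates m n (A - {a})" using A unfolding minimal_percolating_def by blast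
    then have "\<not> spans ?S (int_point ` (A - {a}))" using spans_iff_percolates by blast
    moreover have "int_point ` (A - {a}) \<subseteq> ?S"
      using sp image_mono[of "A - {a}" A int_point] unfolding spans_def by (meson Diff_subset order_trans)
    ultimately obtain K where K: "closed_in ?S K" "int_point ` (A - {a}) \<subseteq> K" "K \<noteq> ?S"
      unfolding spans_def by blast
    have "int_point ` A - {x} \<subseteq> K" using K(2) a by blast
    moreover have "\<not> ?S \<subseteq> K" using K closed_in_subset by blast
    ultimately show "\<exists>K. closed_in ?S K \<and> int_point ` A - {x} \<subseteq> K \<and> \<not> ?S \<subseteq> K"
      using K(1) by blast
  qed
qed

lemma card_le_E:
  assumes "min_spans (rect 1 (int m) 1 (int n)) B (rect 1 (int m) 1 (int n))"
  shows "card B \<le> E m n"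
proof -
  have "B \<subseteq> int_point ` grid m n"
    using assms unfolding min_spans_def spans_def int_point_grid by blast
  then obtain A where B: "B = int_point ` A" by (meson subset_imageE)
  then have "minimal_percolating m n A" using assms min_spans_iff_minimal_percolating by blast
  then have "card A \<le> E m n"
    unfolding E_def by (intro Max_ge finite_minimal_percolating_cards) blast
  then show ?thesis using B by (simp add: card_image inj_on_subset[OF inj_int_point])
qed

lemma obtain_E:
  obtains B where "min_spans (rect 1 (int m) 1 (int n)) B (rect 1 (int m) 1 (int n))"
    "card B = E m n"
proof -
  have "E m n \<in> {card A |A. minimal_percolating m n A}"
    unfolding E_def
    by (rule Max_in[OF finite_minimal_percolating_cards]) (use minimal_percolating_exists in blast)
  then obtain A where A: "minimal_percolating m n A" "card A = E m n" by force
  then have "card (int_point ` A) = E m n"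
    by (simp add: card_image inj_on_subset[OF inj_int_point])
  then show thesis using that A(1) min_spans_iff_minimal_percolating by blast
qed

lemma E_le: "E m n \<le> m * n"
proof -
  obtain B where B: "min_spans (rect 1 (int m) 1 (int n)) B (rect 1 (int m) 1 (int n))"
    "card B = E m n" by (rule obtain_E)
  then have "card B \<le> card (rect 1 (int m) 1 (int n))"
    unfolding min_spans_def spans_def by (intro card_mono) auto
  then show ?thesis using B(2) by (simp add: rect_def)
qed

lemma E_commute_le: "E m n \<le> E n m"
proof -
  obtain B where B: "min_spans (rect 1 (int m) 1 (int n)) B (rect 1 (int m) 1 (int n))"
    "card B = E m n" by (rule obtain_E)
  have "card (prod.swap ` B) \<le> E n m"
    using min_spans_isometry[OF bij_swap adj_swap B(1)] by (intro card_le_E) (simp add: swap_rect)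
  then show ?thesis using B(2) by (simp add: card_image)
qed

lemma E_commute: "E m n = E n m"
  by (simp add: E_commute_le antisym)

lemma E_join:
  assumes pos: "1 \<le> w1" "1 \<le> w2" "1 \<le> h2" "h2 \<le> h1"
  shows "E w1 h1 + E w2 h2 \<le> E (w1 + w2 + 7) (h1 + 4)"
proof -
  obtain A where A: "min_spans (rect 1 (int w1) 1 (int h1)) A (rect 1 (int w1) 1 (int h1))"
    "card A = E w1 h1" by (rule obtain_E)
  obtain B where B: "min_spans (rect 1 (int w2) 1 (int h2)) B (rect 1 (int w2) 1 (int h2))"
    "card B = E w2 h2" by (rule obtain_E)
  define a b w d where "a = int w1 + 2" and "b = int h1 + 2" and "w = int w1 + int w2 + 7"
    and "d = int h2 + 2"
  define A' where "A' = insert (1, b) (insert (a, 1) A)"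
  define B0 where "B0 = insert (1, d) (insert (int w2 + 2, 1) B)"
  let ?f = "point_reflect (w + 1, d + 1)"
  define B' where "B' = ?f ` B0"
  have A': "min_spans (rect 1 a 1 b) A' {(a, b)}"
    using min_spans_corner[OF A(1)] pos unfolding A'_def a_def b_def by simp
  have "min_spans (rect 1 (int w2 + 2) 1 d) B0 {(int w2 + 2, d)}"
    using min_spans_corner[OF B(1)] pos unfolding B0_def d_def by simp
  from min_spans_isometry[OF bij_point_reflect adj_point_reflect this, of "(w + 1, d + 1)"]
  have B': "min_spans (rect (a + 4) w 1 d) B' {(a + 4, 1)}"
    unfolding B'_def point_reflect_rect
    by (simp add: point_reflect_def a_def w_def algebra_simps)
  define C where "C = insert (a + 1, b + 1) (insert (a + 3, 0) (A' \<union> B'))"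
  have "min_spans (rect 1 w 0 (b + 1)) C (rect 1 w 0 (b + 1))"
    unfolding C_def by (rule min_spans_join[OF A' B']) (use pos in \<open>simp_all add: a_def b_def w_def d_def\<close>)
  from min_spans_isometry[OF bij_translate adj_translate this, of "(0, 1)"]
  have C: "card (translate (0, 1) ` C) \<le> E (w1 + w2 + 7) (h1 + 4)"
    by (intro card_le_E) (simp add: translate_rect b_def w_def algebra_simps)
  note sub = min_spans_subset[OF A'] min_spans_subset[OF B']
  have disj: "A' \<inter> B' = {}" using sub by (force simp: rect_def)
  have finA': "finite A'" "finite B'" using sub finite_rect finite_subset by blast+
  have finB: "finite B" using min_spans_subset[OF B(1)] finite_rect finite_subset by blast
  have "card A \<le> card A'"
    using finA' by (intro card_mono) (auto simp: A'_def)
  moreover have "card B \<le> card B0"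
    using finB by (intro card_mono) (auto simp: B0_def)
  moreover have "card B' = card B0"
    unfolding B'_def by (intro card_image inj_on_subset[OF bij_is_inj[OF bij_point_reflect]]) simp
  moreover have "card A' + card B' = card (A' \<union> B')"
    using finA' disj by (simp add: card_Un_disjoint)
  moreover have "card (A' \<union> B') \<le> card C"
    using finA' by (intro card_mono) (auto simp: C_def)
  moreover have "card (translate (0, 1) ` C) = card C"
    by (intro card_image inj_on_subset[OF bij_is_inj[OF bij_translate]]) simp
  ultimately show ?thesis using C A(2) B(2) by linarith
qed

subsection \<open>Existence of the limit\<close>

lemma E_mono:
  assumes "1 \<le> w" "1 \<le> h" "w + 12 \<le> w'" "h + 12 \<le> h'"
  shows "E w h \<le> E w' h'"
proof -
  have "E w h \<le> E w h + E (w' - w - 11) 1" by simp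
  also have "\<dots> \<le> E (w + (w' - w - 11) + 7) (h + 4)"
    by (rule E_join) (use assms in linarith)+
  also have "\<dots> = E (h + 4) (w' - 4)"
    using assms by (subst E_commute) simp
  also have "\<dots> \<le> E (h + 4) (w' - 4) + E (h' - h - 11) 1" by simp
  also have "\<dots> \<le> E (h + 4 + (h' - h - 11) + 7) (w' - 4 + 4)"
    by (rule E_join) (use assms in linarith)+
  also have "\<dots> = E w' h'"
    using assms by (subst E_commute) simp
  finally show ?thesis .
qed

lemma E_row:
  assumes "1 \<le> w" "1 \<le> h"
  shows "Suc q * E w h \<le> E (Suc q * w + 7 * q) (h + 4 * q)"
proof (induction q)
  case (Suc q)
  have "E (Suc q * w + 7 * q) (h + 4 * q) + E w h
      \<le> E (Suc q * w + 7 * q + w + 7) (h + 4 * q + 4)"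
    by (rule E_join) (use assms in auto)
  then show ?case using Suc by (simp add: algebra_simps)
qed simp

lemma E_square:
  assumes k: "1 \<le> k" and q: "1 \<le> q" and n: "q * (k + 4 * q + 11) + 12 \<le> n"
  shows "q\<^sup>2 * E k k \<le> E n n"
proof -
  obtain r where r: "q = Suc r" using q by (cases q) auto
  let ?W = "q * k + 7 * r" and ?H = "k + 4 * r"
  have "q * (q * E k k) \<le> q * E ?W ?H"
    using E_row[OF k k, of r] r by (intro mult_le_mono2) simp
  also have "\<dots> = q * E ?H ?W" by (subst E_commute) simp
  also have "\<dots> \<le> E (q * ?H + 7 * r) (?W + 4 * r)"
    using E_row[of ?H ?W r] k r by simp
  also have "\<dots> \<le> E n n"
  proof (intro E_mono)
    show "q * ?H + 7 * r + 12 \<le> n" "?W + 4 * r + 12 \<le> n"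
      using n r by (auto simp: algebra_simps)
  qed (use k r in auto)
  finally show ?thesis by (simp add: power2_eq_square mult.assoc)
qed

lemma E_lower_bound:
  assumes p: "1 \<le> p" and k: "62 \<le> k" and m: "p * (k + 8 * p + 11) + 12 \<le> m"
  shows "(real p / (real p + 1) / (real k + 8 * real p + 74))\<^sup>2 * real (E k k) * (real m + 51)\<^sup>2
    \<le> real (E m m)"
  using m
proof (induction m rule: less_induct)
  case (less m)
  define D where "D = k + 8 * p + 11"
  define c where "c = real p / (real p + 1) / (real k + 8 * real p + 74)"
  have D: "real k + 8 * real p + 74 = real D + 63" by (simp add: D_def)
  have m: "p * D + 12 \<le> m" using less.prems by (simp add: D_def)
  show ?case
  proof (cases "m < 2 * (p * D + 12) + 50")
    case True
    define q where "q = (m - 12) div D"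
    have D0: "62 \<le> D" using k by (simp add: D_def)
    have "p \<le> q" unfolding q_def using m D0 by (simp add: less_eq_div_iff_mult_less_eq)
    have "m - 12 < (2 * p + 1) * D" using True D0 by simp
    then have "q < 2 * p + 1" unfolding q_def by (simp add: less_mult_imp_div_less)
    have "q * D \<le> m - 12" unfolding q_def by simp
    moreover have "q * (k + 4 * q + 11) \<le> q * D"
      using \<open>q < 2 * p + 1\<close> unfolding D_def by (intro mult_le_mono2) simp
    ultimately have "q * (k + 4 * q + 11) + 12 \<le> m"
      using m by linarith
    then have E: "q\<^sup>2 * E k k \<le> E m m"
      using k p \<open>p \<le> q\<close> by (intro E_square) simp_all
    have "m - 12 < (q + 1) * D"
      using D0 unfolding q_def by (metis Suc_eq_plus1 dividend_less_div_times mult.commute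
          mult_Suc_right add.commute less_le_trans zero_less_numeral)
    then have "m < (q + 1) * D + 12" by linarith
    then have "real m < (real q + 1) * real D + 12"
      by (metis (no_types, lifting) of_nat_1 of_nat_add of_nat_less_iff of_nat_mult of_nat_numeral)
    then have "real m + 51 \<le> (real q + 1) * (real D + 63)"
      by (simp add: algebra_simps)
    then have "c * (real m + 51) \<le> c * ((real q + 1) * (real D + 63))"
      by (intro mult_left_mono) (simp_all add: c_def)
    also have "\<dots> = real p / (real p + 1) * (real q + 1)"
      unfolding c_def D by simp
    also have "\<dots> \<le> real q"
      using \<open>p \<le> q\<close> by (simp add: field_simps)
    finally have "(c * (real m + 51))\<^sup>2 \<le> (real q)\<^sup>2"
      by (intro power_mono) (simp_all add: c_def)
    then have "(c * (real m + 51))\<^sup>2 * real (E k k) \<le> (real q)\<^sup>2 * real (E k k)"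
      by (intro mult_right_mono) simp_all
    also have "\<dots> \<le> real (E m m)"
      using E by (metis of_nat_le_iff of_nat_mult of_nat_power)
    finally have "c\<^sup>2 * real (E k k) * (real m + 51)\<^sup>2 \<le> real (E m m)"
      by (simp add: power_mult_distrib mult_ac)
    then show ?thesis unfolding c_def .
  next
    case False
    define l where "l = (m - 50) div 2"
    have l: "p * D + 12 \<le> l" "l < m" "2 * l + 50 \<le> m" "m \<le> 2 * l + 51"
      using False unfolding l_def by auto
    have "real m + 51 \<le> 2 * (real l + 51)" using of_nat_mono[OF l(4), where 'a = real] by simp
    then have "(real m + 51)\<^sup>2 \<le> (2 * (real l + 51))\<^sup>2" by (intro power_mono) simp_all
    then have "c\<^sup>2 * real (E k k) * (real m + 51)\<^sup>2 \<le> c\<^sup>2 * real (E k k) * (2 * (real l + 51))\<^sup>2"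
      by (intro mult_left_mono) simp_all
    also have "\<dots> = 4 * (c\<^sup>2 * real (E k k) * (real l + 51)\<^sup>2)"
      by (simp add: power2_eq_square algebra_simps)
    also have "\<dots> \<le> 4 * real (E l l)"
      using less.IH[of l] l unfolding c_def D_def by simp
    also have "\<dots> \<le> real (E m m)"
      using E_square[of l 2 m] l by simp
    finally show ?thesis unfolding c_def .
  qed
qed

lemma convergent_if_almost_increasing:
  fixes a :: "nat \<Rightarrow> real"
  assumes bd: "\<And>n. a n \<in> {l..u}"
    and inc: "\<And>e. e > 0 \<Longrightarrow> \<exists>K. \<forall>k\<ge>K. \<exists>M. \<forall>m\<ge>M. a k - e \<le> a m"
  shows "convergent a"
proof -
  obtain b r where r: "strict_mono r" "(a \<circ> r) \<longlonglongrightarrow> b"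
    using compact_imp_seq_compact[OF compact_Icc] bd unfolding seq_compact_def by metis
  have "a \<longlonglongrightarrow> b"
  proof (rule LIMSEQ_I)
    fix e :: real assume "e > 0"
    then obtain K where K: "\<And>k. k \<ge> K \<Longrightarrow> \<exists>M. \<forall>m\<ge>M. a k - e / 3 \<le> a m"
      using inc[of "e / 3"] by auto
    obtain J where J: "\<And>j. j \<ge> J \<Longrightarrow> \<bar>a (r j) - b\<bar> < e / 3"
      using LIMSEQ_D[OF r(2), of "e / 3"] \<open>e > 0\<close> by auto
    have r_ge: "r j \<ge> j" for j by (rule seq_suble[OF r(1)])
    have upper: "a k < b + e" if k: "k \<ge> K" for k
    proof -
      obtain M where M: "\<And>m. m \<ge> M \<Longrightarrow> a k - e / 3 \<le> a m" using K[OF k] by blast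
      have "a k - e / 3 \<le> a (r (max J M))"
        using r_ge[of "max J M"] by (intro M) simp
      moreover have "\<bar>a (r (max J M)) - b\<bar> < e / 3" by (rule J) simp
      ultimately show ?thesis using \<open>e > 0\<close> by linarith
    qed
    let ?k = "r (max J K)"
    have "?k \<ge> K" using r_ge[of "max J K"] by simp
    then obtain M where M: "\<And>m. m \<ge> M \<Longrightarrow> a ?k - e / 3 \<le> a m" using K by blast
    have "norm (a m - b) < e" if m: "m \<ge> max K M" for m
    proof -
      have "\<bar>a ?k - b\<bar> < e / 3" by (rule J) simp
      moreover have "a m < b + e" "a ?k - e / 3 \<le> a m" using upper M m by simp_all
      ultimately have "\<bar>a m - b\<bar> < e" using \<open>e > 0\<close> by linarith
      then show ?thesis by simp
    qed
    then show "\<exists>no. \<forall>n\<ge>no. norm (a n - b) < e" by blast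
  qed
  then show ?thesis by (rule convergentI)
qed

theorem theorem1p2:
  shows "convergent (\<lambda>n. real (E n n) / (real n)\<^sup>2)"
proof (rule convergent_if_almost_increasing)
  let ?a = "\<lambda>n. real (E n n) / (real n)\<^sup>2"
  have le1: "?a n \<le> 1" for n
  proof -
    have "real (E n n) \<le> real (n * n)" using E_le[of n n] by (simp only: of_nat_le_iff)
    then show ?thesis by (cases "n = 0") (simp_all add: power2_eq_square)
  qed
  then show "?a n \<in> {0..1}" for n by simp
  fix e :: real assume e: "e > 0"
  have "(\<lambda>p. (real p / (real p + 1))\<^sup>2) \<longlonglongrightarrow> 1" by real_asymp
  then have "\<forall>\<^sub>F p in sequentially. 1 - e < (real p / (real p + 1))\<^sup>2"
    by (rule order_tendstoD) (use e in simp)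
  then obtain p where p: "1 \<le> p" "1 - e < (real p / (real p + 1))\<^sup>2"
    using eventually_happens'[OF _ eventually_conj[OF _ eventually_ge_at_top[of 1]]] by force
  define s where "s k = (real p / (real p + 1) / (real k + 8 * real p + 74))\<^sup>2" for k
  have "(\<lambda>k. real k / (real k + 8 * real p + 74)) \<longlonglongrightarrow> 1" by real_asymp
  then have "(\<lambda>k. (real p / (real p + 1) * (real k / (real k + 8 * real p + 74)))\<^sup>2)
      \<longlonglongrightarrow> (real p / (real p + 1) * 1)\<^sup>2"
    by (intro tendsto_intros)
  then have "\<forall>\<^sub>F k in sequentially.
      1 - e < (real p / (real p + 1) * (real k / (real k + 8 * real p + 74)))\<^sup>2"
    by (rule order_tendstoD) (use p in simp)
  then obtain K where
    K: "\<And>k. k \<ge> K \<Longrightarrow> 1 - e < (real p / (real p + 1) * (real k / (real k + 8 * real p + 74)))\<^sup>2"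
    unfolding eventually_sequentially by blast
  have "?a k - e \<le> ?a m" if k: "k \<ge> max K 62" and m: "m \<ge> p * (k + 8 * p + 11) + 12" for k m
  proof -
    have "1 - e < s k * (real k)\<^sup>2"
      using K[of k] k by (simp add: s_def power_mult_distrib power_divide)
    then have "(1 - e) * ?a k \<le> s k * (real k)\<^sup>2 * ?a k"
      by (intro mult_right_mono) simp_all
    also have "\<dots> = s k * real (E k k)" using k by simp
    also have "\<dots> \<le> real (E m m) / (real m + 51)\<^sup>2"
      using E_lower_bound[OF p(1) _ m] k by (simp add: s_def pos_le_divide_eq)
    also have "\<dots> \<le> ?a m"
      using m by (intro divide_left_mono power_mono) simp_all
    finally have "?a k - e * ?a k \<le> ?a m" by (simp only: left_diff_distrib mult_1)
    moreover have "e * ?a k \<le> e * 1" using le1[of k] e by (intro mult_left_mono) simp_all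
    ultimately show ?thesis by simp
  qed
  then show "\<exists>K. \<forall>k\<ge>K. \<exists>M. \<forall>m\<ge>M. ?a k - e \<le> ?a m" by blast
qed

end
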